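(* Let $0\le\lambda\le1$ and $-1\le B<A\le1$ be real numbers, and let $f(z)=z+\sum_{n=2}^{\infty}a_nz^n$ belong to the class $\mathcal Q_{\mathcal{CV}}(\lambda,A,B)$. Then for every integer $n\ge2$, $$|a_n|\le\frac{1}{1+(n-1)\lambda}\left(1+\frac{(n-1)(A-B)}{2}\right).$$
   Context: $\mathbb D=\{z\in\mathbb C:|z|<1\}$. $\mathcal A$ is the family of functions analytic in $\mathbb D$ of the form $f(z)=z+\sum_{n\ge2}a_nz^n$. For analytic $F,G$ on $\mathbb D$ with $F(0)=G(0)$, $F$ is subordinate to $G$, written $F\prec G$, if there is an analytic function $h$ on $\mathbb D$ with $h(0)=0$, $|h(z)|<1$ and $F(z)=G(h(z))$ for all $z\in\mathbb D$. $\mathcal K$ is the class of convex functions: those $g\in\mathcal A$ with $1+\frac{zg''(z)}{g'(z)}\prec\frac{1+z}{1-z}$ in $\mathbb D$. For $0\le\lambda\le1$ and $-1\le B<A\le1$, $\mathcal Q_{\mathcal{CV}}(\lambda,A,B)$ is the class of $f\in\mathcal A$ for which there exists $g\in\mathcal K$ with $$\frac{f'(z)+\lambda zf''(z)}{g'(z)}\prec\frac{1+Az}{1+Bz}\qquad(z\in\mathbb D).$$ *)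

theory Defs
  imports "HOL-Complex_Analysis.Complex_Analysis"
begin

abbreviation unit_disc :: "complex set" where
  "unit_disc \<equiv> ball 0 1"

definition class_A :: "(complex \<Rightarrow> complex) set" where
  "class_A = {f. f holomorphic_on unit_disc \<and>
     (\<exists>a :: nat \<Rightarrow> complex. \<forall>z\<in>unit_disc. (\<lambda>n. a (n + 2) * z ^ (n + 2)) sums (f z - z))}"

definition subordinate :: "(complex \<Rightarrow> complex) \<Rightarrow> (complex \<Rightarrow> complex) \<Rightarrow> bool" where
  "subordinate F G \<longleftrightarrow>
     F holomorphic_on unit_disc \<and> G holomorphic_on unit_disc \<and> F 0 = G 0 \<and>
     (\<exists>h. h holomorphic_on unit_disc \<and> h 0 = 0 \<and>
          (\<forall>z\<in>unit_disc. norm (h z) < 1 \<and> F z = G (h z)))"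

(* The convention x / 0 = 0 is harmless here: deriv g 0 = 1, so at a zero of deriv g in the
   disc the logarithmic derivative of deriv g would have a genuine pole, contradicting the
   holomorphy required by subordinate. Hence deriv g has no zero in the disc, which also
   makes the quotient in class_Q_CV an ordinary one. *)
definition class_K :: "(complex \<Rightarrow> complex) set" where
  "class_K = {g \<in> class_A.
     subordinate (\<lambda>z. 1 + z * deriv (deriv g) z / deriv g z) (\<lambda>z. (1 + z) / (1 - z))}"

definition class_Q_CV :: "real \<Rightarrow> real \<Rightarrow> real \<Rightarrow> (complex \<Rightarrow> complex) set" where
  "class_Q_CV l A B = {f \<in> class_A. \<exists>g\<in>class_K.
     subordinate (\<lambda>z. (deriv f z + of_real l * z * deriv (deriv f) z) / deriv g z)
                 (\<lambda>z. (1 + of_real A * z) / (1 + of_real B * z))}"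

end

(* Coefficient bounds for a function P subordinate to (1 + A z) / (1 + B z): the values w of P satisfy
   |w - 1| < |A - B w|, which is a convex condition. Averaging P over the rotations by n-th roots of
   unity therefore gives H = 1 + p_n z^n + ... with the same property, and (H - 1) / (A - B H) is
   bounded by 1 with n-th coefficient p_n / (A - B); Cauchy's inequality yields |p_n| <= A - B.
   With A = 1, B = -1 this is applied to 1 + z g'' / g', and recursion on the coefficients of g' shows
   that they are bounded by those of 1 / (1 - z)^2. The claim follows by comparing
   coefficients in f' + l z f'' = g' P. *)

theory Submission
  imports Defs
begin

section \<open>Power series of a germ, and Cauchy's inequality on the unit disc\<close>

lemma has_fps_expansion_eventually_eq:
  assumes "f has_fps_expansion F" "\<forall>\<^sub>F z in nhds 0. f z = g z"
  shows "g has_fps_expansion F"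
  using has_fps_expansion_cong[OF assms(2) refl, of F] assms(1) by simp

text \<open>Cauchy's inequality on the circle of radius r < 1 gives the bound r^(-n). Nothing is
  known on the unit circle itself, so r tends to 1 from below.\<close>

lemma norm_fps_nth_le_1:
  fixes f :: "complex \<Rightarrow> complex"
  assumes hol: "f holomorphic_on unit_disc" and F: "f has_fps_expansion F"
    and le: "\<And>z. z \<in> unit_disc \<Longrightarrow> norm (f z) \<le> 1"
  shows "norm (fps_nth F n) \<le> 1"
proof -
  have bound: "norm (fps_nth F n) * r ^ n \<le> 1" if r: "0 < r" "r < 1" for r :: real
  proof -
    have "norm ((deriv ^^ n) f 0) \<le> fact n * 1 / r ^ n"
    proof (rule Cauchy_inequality)
      show "f holomorphic_on ball 0 r"
        using hol by (rule holomorphic_on_subset) (use r in auto)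
      have "f holomorphic_on cball 0 r"
        using hol by (rule holomorphic_on_subset) (use r in auto)
      then show "continuous_on (cball 0 r) f"
        by (rule holomorphic_on_imp_continuous_on)
    qed (use r le in auto)
    then show ?thesis
      using r by (simp add: fps_nth_fps_expansion[OF F] norm_divide field_simps)
  qed
  have "((\<lambda>r. norm (fps_nth F n) * r ^ n) \<longlongrightarrow> norm (fps_nth F n) * 1 ^ n) (at_left (1::real))"
    by (intro tendsto_intros)
  moreover have "\<forall>\<^sub>F r in at_left (1::real). norm (fps_nth F n) * r ^ n \<le> 1"
    using eventually_at_left_real[OF zero_less_one] by eventually_elim (use bound in auto)
  ultimately have "norm (fps_nth F n) * 1 ^ n \<le> 1"
    by (rule tendsto_upperbound) simp
  then show ?thesis by simp
qed

section \<open>Coefficients of functions subordinate to (1 + A z) / (1 + B z)\<close>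

text \<open>This is a geometric sum with ratio \<open>w\<close>, where \<open>w ^ n = 1\<close> but
  \<open>w \<noteq> 1\<close> because 0 < m < n. It removes the coefficients strictly between 0 and
  n when a function is averaged over rotations.\<close>

lemma sum_powers_root_of_unity:
  fixes m n :: nat
  assumes "0 < m" "m < n"
  shows "(\<Sum>k<n. (cis (2 * pi * real k / real n)) ^ m) = 0"
proof -
  define w where "w = cis (2 * pi * real m / real n)"
  have "w \<noteq> 1"
  proof
    assume "w = 1"
    then have "cis (2 * pi * real m / real n) = cis (2 * pi * real 0 / real n)"
      by (simp add: w_def)
    moreover have "inj_on (\<lambda>k. cis (2 * pi * real k / real n)) {..<n}"
      using Complex.bij_betw_roots_unity[of n] assms by (auto simp: bij_betw_def)
    ultimately show False
      using inj_onD[of "\<lambda>k. cis (2 * pi * real k / real n)" "{..<n}" m 0] assms by auto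
  qed
  have "w ^ n = cis (2 * pi * real m)"
    using assms by (simp add: w_def Complex.DeMoivre)
  then have "w ^ n = 1"
    by (metis cis_multiple_2pi Ints_of_nat)
  have "(\<Sum>k<n. (cis (2 * pi * real k / real n)) ^ m) = (\<Sum>k<n. w ^ k)"
    by (intro sum.cong refl) (simp add: w_def Complex.DeMoivre mult_ac)
  also have "\<dots> = 0"
    using \<open>w \<noteq> 1\<close> \<open>w ^ n = 1\<close> by (simp add: geometric_sum)
  finally show ?thesis .
qed

text \<open>Squaring both norms turns the condition into \<open>\<phi> w < 0\<close>. The quadratic
  part of \<open>\<phi>\<close> is (1 - B^2) |w|^2 with 1 - B^2 nonnegative, so
  \<open>\<phi>\<close> is a convex function and its sublevel set is convex.\<close>

lemma convex_apollonius_region: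
  fixes A B :: real
  assumes "\<bar>B\<bar> \<le> 1"
  shows "convex {w :: complex. norm (w - 1) < norm (of_real A - of_real B * w)}"
proof -
  define \<phi> where "\<phi> w = (1 - B\<^sup>2) * ((Re w)\<^sup>2 + (Im w)\<^sup>2) - 2 * (1 - A * B) * Re w + (1 - A\<^sup>2)"
    for w :: complex
  have iff: "norm (w - 1) < norm (of_real A - of_real B * w) \<longleftrightarrow> \<phi> w < 0" for w
  proof -
    have "norm (w - 1) < norm (of_real A - of_real B * w) \<longleftrightarrow>
          (norm (w - 1))\<^sup>2 < (norm (of_real A - of_real B * w))\<^sup>2"
      by (metis norm_ge_zero power2_less_imp_less power_strict_mono zero_less_numeral)
    also have "\<dots> \<longleftrightarrow> \<phi> w < 0"
      unfolding cmod_power2 by (simp add: \<phi>_def algebra_simps power2_eq_square)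
    finally show ?thesis .
  qed
  have B: "1 - B\<^sup>2 \<ge> 0"
    using assms by (simp add: abs_square_le_1)
  show ?thesis
    unfolding iff
  proof (rule convexI)
    fix x y :: complex and u v :: real
    assume x: "x \<in> {w. \<phi> w < 0}" and y: "y \<in> {w. \<phi> w < 0}"
      and uv: "0 \<le> u" "0 \<le> v" "u + v = 1"
    have v: "v = 1 - u" using uv by simp
    \<comment> \<open>The affine part of \<open>\<phi>\<close> cancels, and |w|^2 contributes
      exactly u v |x - y|^2.\<close>
    have "u * \<phi> x + v * \<phi> y - \<phi> (u *\<^sub>R x + v *\<^sub>R y)
          = (1 - B\<^sup>2) * (u * v * ((Re x - Re y)\<^sup>2 + (Im x - Im y)\<^sup>2))"
      unfolding \<phi>_def v by (simp add: algebra_simps power2_eq_square)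
    also have "\<dots> \<ge> 0"
      using B uv by (intro mult_nonneg_nonneg) auto
    finally have "\<phi> (u *\<^sub>R x + v *\<^sub>R y) \<le> u * \<phi> x + v * \<phi> y" by simp
    also have "\<dots> < 0"
    \<comment> \<open>Strictness needs a point with positive weight: \<open>y\<close> if u = 0,
      since then v = 1, and \<open>x\<close> otherwise.\<close>
    proof (cases "u = 0")
      case True
      then show ?thesis using y uv by simp
    next
      case False
      then have "u * \<phi> x < 0" using x uv by (simp add: mult_pos_neg)
      moreover have "v * \<phi> y \<le> 0" using y uv by (simp add: mult_nonneg_nonpos)
      ultimately show ?thesis by simp
    qed
    finally show "u *\<^sub>R x + v *\<^sub>R y \<in> {w. \<phi> w < 0}" by simp
  qed
qed

text \<open>If P z = (1 + A w) / (1 + B w), then P z - 1 is w times A - B P z, and |w| < 1. The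
  resulting condition on values no longer mentions w, so it can be averaged.\<close>

lemma subordinate_janowski_region:
  fixes A B :: real
  assumes "-1 \<le> B" "B < A" "A \<le> 1"
    and "subordinate P (\<lambda>z. (1 + of_real A * z) / (1 + of_real B * z))" and "z \<in> unit_disc"
  shows "norm (P z - 1) < norm (of_real A - of_real B * P z)"
proof -
  obtain w where w: "norm w < 1" "P z = (1 + of_real A * w) / (1 + of_real B * w)"
    using assms unfolding subordinate_def by blast
  have "norm (of_real B * w) \<le> 1 * norm w"
    unfolding norm_mult using assms by (intro mult_right_mono) auto
  then have nz: "1 + of_real B * w \<noteq> 0"
    using w(1) by (metis add_eq_0_iff less_le_not_le mult_1 norm_minus_cancel norm_one)
  have "P z - 1 = of_real (A - B) * w / (1 + of_real B * w)"
    "of_real A - of_real B * P z = of_real (A - B) / (1 + of_real B * w)"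
    using nz by (simp_all add: w(2) field_simps)
  then show ?thesis
    using nz w(1) assms by (simp add: norm_divide norm_mult divide_strict_right_mono del: of_real_diff)
qed

text \<open>Comparing coefficients directly in (P - 1) / (A - B P) would mix the n-th coefficient of
  P with products of lower ones. Averaging over rotations makes the lower ones vanish first.\<close>

lemma janowski_coeff_bound:
  fixes A B :: real
  assumes AB: "-1 \<le> B" "B < A" "A \<le> 1"
    and sub: "subordinate P (\<lambda>z. (1 + of_real A * z) / (1 + of_real B * z))"
    and F: "P has_fps_expansion F" and n: "0 < n"
  shows "norm (fps_nth F n) \<le> A - B"
proof -
  define \<zeta> where "\<zeta> k = cis (2 * pi * real k / real n)" for k
  define H where "H z = (\<Sum>k<n. of_real (1 / n) * P (\<zeta> k * z))" for z
  \<comment> \<open>The Moebius map applied to \<open>H\<close> is the inverse of w -> (1 + A w) /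
    (1 + B w).\<close>
  define W where "W z = (H z - 1) / (of_real A - of_real B * H z)" for z
  define FH where "FH = (\<Sum>k<n. fps_const (of_real (1 / n)) * (F oo (fps_const (\<zeta> k) * fps_X)))"
  let ?R = "{w :: complex. norm (w - 1) < norm (of_real A - of_real B * w)}"
  have holP: "P holomorphic_on unit_disc" and P0: "P 0 = 1"
    using sub by (auto simp: subordinate_def)
  have rot: "\<zeta> k * z \<in> unit_disc" if "z \<in> unit_disc" for k z
    using that by (simp add: \<zeta>_def norm_mult)
  have holH: "H holomorphic_on unit_disc"
    unfolding H_def
  proof (intro holomorphic_intros)
    fix k
    have "(P \<circ> (\<lambda>z. \<zeta> k * z)) holomorphic_on unit_disc"
      by (rule holomorphic_on_compose_gen[OF _ holP]) (use rot in \<open>auto intro!: holomorphic_intros\<close>)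
    then show "(\<lambda>z. P (\<zeta> k * z)) holomorphic_on unit_disc" by (simp add: o_def)
  qed
  have HR: "norm (H z - 1) < norm (of_real A - of_real B * H z)" if z: "z \<in> unit_disc" for z
  proof -
    have "(\<Sum>k<n. (1 / real n) *\<^sub>R P (\<zeta> k * z)) \<in> ?R"
    proof (rule convex_sum)
      show "convex ?R" using AB by (intro convex_apollonius_region) auto
      show "P (\<zeta> k * z) \<in> ?R" for k
        using subordinate_janowski_region[OF AB sub rot[OF z]] by simp
    qed (use n in auto)
    then show ?thesis by (simp add: H_def scaleR_conv_of_real)
  qed
  have nz: "of_real A - of_real B * H z \<noteq> 0" if "z \<in> unit_disc" for z
    using HR[OF that] by (metis norm_not_less_zero norm_zero)
  have holW: "W holomorphic_on unit_disc"
    unfolding W_def using nz by (intro holomorphic_intros holH) auto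
  have W1: "norm (W z) \<le> 1" if "z \<in> unit_disc" for z
    using HR[OF that] nz[OF that] by (simp add: W_def norm_divide field_simps)
  have FW: "W has_fps_expansion fps_expansion W 0"
    using holW by (intro has_fps_expansion_fps_expansion) auto
  have FHe: "H has_fps_expansion FH"
    unfolding H_def FH_def
  proof (intro fps_expansion_intros)
    fix k
    have "(P \<circ> (\<lambda>z. \<zeta> k * z)) has_fps_expansion (F oo (fps_const (\<zeta> k) * fps_X))"
      by (intro fps_expansion_intros F) simp
    then show "(\<lambda>z. P (\<zeta> k * z)) has_fps_expansion (F oo (fps_const (\<zeta> k) * fps_X))"
      by (simp add: o_def)
  qed
  \<comment> \<open>Rotation by \<open>\<zeta> k\<close> multiplies the m-th coefficient by
    \<open>\<zeta> k ^ m\<close>. The mean of these powers is 1 for m = 0 and m = n, and 0 strictly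
    in between.\<close>
  have FHm: "fps_nth FH m = of_real (1 / n) * fps_nth F m * (\<Sum>k<n. \<zeta> k ^ m)" for m
    by (simp only: FH_def fps_sum_nth fps_compose_linear)
      (simp add: sum_distrib_left mult_ac)
  have F0: "fps_nth F 0 = 1"
    using F P0 by (simp add: fps_nth_fps_expansion)
  have FH0: "fps_nth FH 0 = 1"
    using n by (simp add: FHm F0)
  have FHlow: "fps_nth FH m = 0" if "0 < m" "m < n" for m
    using sum_powers_root_of_unity[OF that] by (simp add: FHm \<zeta>_def)
  have "\<zeta> k ^ n = 1" for k
  proof -
    have "\<zeta> k ^ n = cis (2 * pi * real k)" using n by (simp add: \<zeta>_def Complex.DeMoivre)
    then show ?thesis by (metis cis_multiple_2pi Ints_of_nat)
  qed
  then have FHn: "fps_nth FH n = fps_nth F n"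
    using n by (simp add: FHm)
  define D where "D = fps_const (of_real A) - fps_const (of_real B) * FH"
  have "(\<lambda>z. W z * (of_real A - of_real B * H z)) has_fps_expansion (fps_expansion W 0 * D)"
    unfolding D_def by (intro fps_expansion_intros FW FHe)
  moreover have "\<forall>\<^sub>F z in nhds 0. W z * (of_real A - of_real B * H z) = H z - 1"
    using eventually_nhds_in_open[of unit_disc 0]
    by (auto elim!: eventually_mono simp: W_def nz simp del: right_minus_eq)
  ultimately have "(\<lambda>z. H z - 1) has_fps_expansion (fps_expansion W 0 * D)"
    by (rule has_fps_expansion_eventually_eq)
  moreover have "(\<lambda>z. H z - 1) has_fps_expansion (FH - 1)"
    by (intro fps_expansion_intros FHe)
  ultimately have eq: "fps_expansion W 0 * D = FH - 1"
    by (rule fps_expansion_unique_complex)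
  have D0: "fps_nth D 0 = of_real (A - B)" and Dlow: "\<And>m. 0 < m \<Longrightarrow> m < n \<Longrightarrow> fps_nth D m = 0"
    using FH0 FHlow by (simp_all add: D_def)
  have "fps_nth (fps_expansion W 0) 0 * of_real (A - B) = 0"
    using arg_cong[OF eq, of "\<lambda>f. fps_nth f 0"] D0 FH0 by simp
  then have W0: "fps_nth (fps_expansion W 0) 0 = 0"
    using AB by simp
  have "fps_nth F n = fps_nth (fps_expansion W 0 * D) n"
    using n by (simp add: eq FHn)
  also have "\<dots> = (\<Sum>i=0..n. fps_nth (fps_expansion W 0) i * fps_nth D (n - i))"
    by (simp add: fps_mult_nth)
  \<comment> \<open>The term i = 0 vanishes since \<open>W\<close> has constant term 0; for 0 < i <
    n the factor from \<open>D\<close> vanishes. What remains is the n-th coefficient of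
    \<open>W\<close> times A - B.\<close>
  also have "\<dots> = (\<Sum>i\<in>{n}. fps_nth (fps_expansion W 0) i * fps_nth D (n - i))"
  proof (rule sum.mono_neutral_right)
    show "\<forall>i\<in>{0..n} - {n}. fps_nth (fps_expansion W 0) i * fps_nth D (n - i) = 0"
    proof
      fix i assume i: "i \<in> {0..n} - {n}"
      show "fps_nth (fps_expansion W 0) i * fps_nth D (n - i) = 0"
        using W0 Dlow[of "n - i"] i by (cases "i = 0") auto
    qed
  qed auto
  finally have "norm (fps_nth F n) = norm (fps_nth (fps_expansion W 0) n) * (A - B)"
    using AB D0 by (simp add: norm_mult del: of_real_diff)
  also have "\<dots> \<le> 1 * (A - B)"
    using AB norm_fps_nth_le_1[OF holW FW W1] by (intro mult_right_mono) auto
  finally show ?thesis by simp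
qed

lemma subordinate_janowski_fps:
  fixes A B :: real
  assumes "-1 \<le> B" "B < A" "A \<le> 1"
    and sub: "subordinate P (\<lambda>z. (1 + of_real A * z) / (1 + of_real B * z))"
  obtains F where "P has_fps_expansion F" "fps_nth F 0 = 1"
    "\<And>n. 0 < n \<Longrightarrow> norm (fps_nth F n) \<le> A - B"
proof (rule that)
  show P: "P has_fps_expansion fps_expansion P 0"
    using sub by (intro has_fps_expansion_fps_expansion[of unit_disc]) (auto simp: subordinate_def)
  show "fps_nth (fps_expansion P 0) 0 = 1"
    using sub by (simp add: subordinate_def fps_expansion_def)
  show "norm (fps_nth (fps_expansion P 0) n) \<le> A - B" if "0 < n" for n
    by (rule janowski_coeff_bound[OF assms P that])
qed

section \<open>Power series of normalized functions and of derivatives of convex functions\<close>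

text \<open>The hypothesis says nothing about \<open>a 0\<close> and \<open>a 1\<close>, so the
  series puts the normalized values 0 and 1 in their place.\<close>

lemma normalized_fps_expansion:
  fixes a :: "nat \<Rightarrow> complex"
  assumes "\<And>z. z \<in> unit_disc \<Longrightarrow> (\<lambda>n. a (n + 2) * z ^ (n + 2)) sums (f z - z)"
  shows "f has_fps_expansion Abs_fps (\<lambda>n. if n = 0 then 0 else if n = 1 then 1 else a n)"
proof (rule has_fps_expansionI)
  let ?c = "\<lambda>n. if n = 0 then 0 else if n = 1 then 1 else a n"
  have "(\<lambda>n. ?c n * z ^ n) sums f z" if "z \<in> unit_disc" for z
  proof -
    have "(\<lambda>n. ?c (n + 2) * z ^ (n + 2)) sums (f z - (\<Sum>i<2. ?c i * z ^ i))"
      using assms[OF that] by (simp add: numeral_2_eq_2)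
    then show ?thesis by (rule sums_iff_shift'[THEN iffD1])
  qed
  then show "\<forall>\<^sub>F z in nhds 0. (\<lambda>n. fps_nth (Abs_fps ?c) n * z ^ n) sums f z"
    using eventually_nhds_in_open[of unit_disc "0::complex"] by (auto elim!: eventually_mono)
qed

text \<open>The sum of i + 1 over i < m is m (m + 1) / 2. The estimate serves twice: with C = 2 in
  the recursion for g', and with C = A - B in the final comparison.\<close>

lemma norm_convolution_le:
  fixes G P :: "complex fps"
  assumes "\<And>i. i < m \<Longrightarrow> norm (fps_nth G i) \<le> real i + 1"
    and "\<And>k. 0 < k \<Longrightarrow> norm (fps_nth P k) \<le> C"
  shows "norm (\<Sum>i<m. fps_nth G i * fps_nth P (m - i)) \<le> C * (real m * (real m + 1) / 2)"
proof -
  have "norm (\<Sum>i<m. fps_nth G i * fps_nth P (m - i)) \<le> (\<Sum>i<m. (real i + 1) * C)"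
    unfolding norm_mult[symmetric]
    by (rule sum_norm_le) (use assms in \<open>auto simp: norm_mult intro!: mult_mono\<close>)
  also have "\<dots> = C * (\<Sum>i<m. real i + 1)"
    by (simp add: sum_distrib_left mult_ac)
  also have "(\<Sum>i<m. real i + 1) = real m * (real m + 1) / 2"
    by (induction m) (auto simp: field_simps)
  finally show ?thesis .
qed

lemma fps_mult_nth_split:
  fixes G P :: "'a :: comm_ring_1 fps"
  assumes "fps_nth P 0 = 1"
  shows "fps_nth (G * P) m = fps_nth G m + (\<Sum>i<m. fps_nth G i * fps_nth P (m - i))"
  using assms by (simp add: fps_mult_nth atLeast0AtMost flip: lessThan_Suc_atMost)

text \<open>With q = 1 + z g'' / g', the identity g' q = g' + z g'' expresses m times the m-th
  coefficient of g' through earlier ones. Since |q_k| is at most 2, strong induction bounds this by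
  2 m (m + 1) / 2, and dividing by m gives m + 1.\<close>

lemma class_K_fps_deriv:
  assumes "g \<in> class_K"
  obtains G where "deriv g has_fps_expansion G" "fps_nth G 0 = 1"
    "\<And>m. norm (fps_nth G m) \<le> real m + 1"
proof -
  obtain b where b: "\<And>z. z \<in> unit_disc \<Longrightarrow> (\<lambda>n. b (n + 2) * z ^ (n + 2)) sums (g z - z)"
    using assms unfolding class_K_def class_A_def by blast
  define G where "G = fps_deriv (Abs_fps (\<lambda>n. if n = 0 then 0 else if n = 1 then 1 else b n))"
  have G: "deriv g has_fps_expansion G"
    unfolding G_def by (intro has_fps_expansion_deriv normalized_fps_expansion b)
  have G0: "fps_nth G 0 = 1" by (simp add: G_def)
  let ?q = "\<lambda>z. 1 + z * deriv (deriv g) z / deriv g z"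
  have sub: "subordinate ?q (\<lambda>z. (1 + of_real 1 * z) / (1 + of_real (-1) * z))"
    using assms by (simp add: class_K_def)
  obtain Q where Q: "?q has_fps_expansion Q" "fps_nth Q 0 = 1"
    "\<And>k. 0 < k \<Longrightarrow> norm (fps_nth Q k) \<le> 1 - (-1)"
    using subordinate_janowski_fps[OF _ _ _ sub] by auto
  \<comment> \<open>By continuity g' is nonzero near 0, as g'(0) = 1. This suffices for cancelling
    the quotient, because an expansion at 0 depends only on the germ.\<close>
  have ev: "\<forall>\<^sub>F z in nhds 0. deriv g z \<noteq> 0"
    using has_fps_expansion_imp_continuous[OF G, of UNIV] G0 fps_nth_fps_expansion[OF G, of 0]
    by (intro tendsto_imp_eventually_ne[of _ 1]) (auto simp: continuous_at tendsto_nhds_iff)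
  have "(\<lambda>z. deriv g z * ?q z) has_fps_expansion G * Q"
    by (intro fps_expansion_intros G Q)
  moreover have "\<forall>\<^sub>F z in nhds 0. deriv g z * ?q z = deriv g z + z * deriv (deriv g) z"
    using ev by eventually_elim (simp add: field_simps)
  ultimately have "(\<lambda>z. deriv g z + z * deriv (deriv g) z) has_fps_expansion G * Q"
    by (rule has_fps_expansion_eventually_eq)
  moreover have "(\<lambda>z. deriv g z + z * deriv (deriv g) z) has_fps_expansion G + fps_X * fps_deriv G"
    by (intro fps_expansion_intros G)
  ultimately have eq: "G * Q = G + fps_X * fps_deriv G"
    by (rule fps_expansion_unique_complex)
  \<comment> \<open>The summand i = m of the product is the m-th coefficient of \<open>G\<close>,
    which cancels against the same term on the right; m = 0 gives 0 = 0.\<close>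
  have rec: "of_nat m * fps_nth G m = (\<Sum>i<m. fps_nth G i * fps_nth Q (m - i))" for m
    using arg_cong[OF eq, of "\<lambda>f. fps_nth f m"] fps_mult_nth_split[OF Q(2), of G m]
    by (cases m) auto
  have bound: "norm (fps_nth G m) \<le> real m + 1" for m
  proof (induction m rule: less_induct)
    case (less m)
    show ?case
    proof (cases "m = 0")
      case True
      then show ?thesis by (simp add: G0)
    next
      case False
      have "real m * norm (fps_nth G m) = norm (of_nat m * fps_nth G m)"
        by (simp add: norm_mult)
      also have "\<dots> \<le> (1 - (-1)) * (real m * (real m + 1) / 2)"
        unfolding rec using less Q(3) by (rule norm_convolution_le)
      finally show ?thesis using False by simp
    qed
  qed
  show thesis by (rule that[OF G G0 bound])
qed

section \<open>Comparison of coefficients in f' + l z f'' = g' P\<close>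

theorem corollary5:
  fixes l A B :: real and f :: "complex \<Rightarrow> complex" and a :: "nat \<Rightarrow> complex"
  assumes "0 \<le> l" and "l \<le> 1"
    and "-1 \<le> B" and "B < A" and "A \<le> 1"
    and "f \<in> class_Q_CV l A B"
    and "\<And>z. z \<in> unit_disc \<Longrightarrow> (\<lambda>n. a (n + 2) * z ^ (n + 2)) sums (f z - z)"
  shows "\<forall>n\<ge>2. norm (a n) \<le>
    1 / (1 + (real n - 1) * l) * (1 + (real n - 1) * (A - B) / 2)"
proof (intro allI impI)
  fix n :: nat assume n: "2 \<le> n"
  then obtain m where m: "n = Suc m" "0 < m"
    by (cases n) auto
  let ?p = "\<lambda>g z. (deriv f z + of_real l * z * deriv (deriv f) z) / deriv g z"
  obtain g where g: "g \<in> class_K"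
    and sub: "subordinate (?p g) (\<lambda>z. (1 + of_real A * z) / (1 + of_real B * z))"
    using assms(6) by (auto simp: class_Q_CV_def)
  obtain P where P: "?p g has_fps_expansion P" "fps_nth P 0 = 1"
    "\<And>k. 0 < k \<Longrightarrow> norm (fps_nth P k) \<le> A - B"
    using subordinate_janowski_fps[OF assms(3-5) sub] by blast
  obtain G where G: "deriv g has_fps_expansion G" "fps_nth G 0 = 1"
    "\<And>m. norm (fps_nth G m) \<le> real m + 1"
    using class_K_fps_deriv[OF g] by blast
  define F where "F = fps_deriv (Abs_fps (\<lambda>n. if n = 0 then 0 else if n = 1 then 1 else a n))"
  have F: "deriv f has_fps_expansion F"
    unfolding F_def by (intro has_fps_expansion_deriv normalized_fps_expansion assms(7))
  have ev: "\<forall>\<^sub>F z in nhds 0. deriv g z \<noteq> 0"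
    using has_fps_expansion_imp_continuous[OF G(1), of UNIV] G(2) fps_nth_fps_expansion[OF G(1), of 0]
    by (intro tendsto_imp_eventually_ne[of _ 1]) (auto simp: continuous_at tendsto_nhds_iff)
  have "(\<lambda>z. deriv g z * ?p g z) has_fps_expansion G * P"
    by (intro fps_expansion_intros G P)
  moreover have "\<forall>\<^sub>F z in nhds 0. deriv g z * ?p g z
      = deriv f z + of_real l * z * deriv (deriv f) z"
    using ev by eventually_elim (simp add: field_simps)
  ultimately have "(\<lambda>z. deriv f z + of_real l * z * deriv (deriv f) z) has_fps_expansion G * P"
    by (rule has_fps_expansion_eventually_eq)
  moreover have "(\<lambda>z. deriv f z + of_real l * z * deriv (deriv f) z) has_fps_expansion
      F + fps_const (of_real l) * fps_X * fps_deriv F"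
    by (intro fps_expansion_intros F)
  ultimately have eq: "G * P = F + fps_const (of_real l) * fps_X * fps_deriv F"
    by (rule fps_expansion_unique_complex)
  \<comment> \<open>The coefficient of z^m in f' is n a_n with n = m + 1, and z f'' contributes m
    times that. Since m > 0, the index n lies past the two normalized entries.\<close>
  have "fps_nth (G * P) m = of_real ((1 + real m * l) * real n) * a n"
    using m unfolding eq by (cases m) (simp_all add: F_def mult.assoc algebra_simps)
  then have "(1 + real m * l) * real n * norm (a n) = norm (fps_nth (G * P) m)"
    using assms(1) by (simp add: norm_mult del: of_real_add of_real_mult)
  also have "\<dots> \<le> norm (fps_nth G m) + norm (\<Sum>i<m. fps_nth G i * fps_nth P (m - i))"
    unfolding fps_mult_nth_split[OF P(2)] by (rule norm_triangle_ineq)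
  also have "\<dots> \<le> (real m + 1) + (A - B) * (real m * (real m + 1) / 2)"
    by (intro add_mono G norm_convolution_le P)
  \<comment> \<open>Both bounds contain the factor m + 1 = n, which then cancels against the n in n
    a_n.\<close>
  also have "\<dots> = real n * (1 + real m * (A - B) / 2)"
    using m by (simp add: field_simps)
  finally have "real n * ((1 + real m * l) * norm (a n)) \<le> real n * (1 + real m * (A - B) / 2)"
    by (simp add: mult_ac)
  then have "(1 + real m * l) * norm (a n) \<le> 1 + real m * (A - B) / 2"
    using n by (simp add: mult_le_cancel_left_pos)
  moreover have "1 + real m * l > 0"
    using assms(1) by (simp add: add_pos_nonneg)
  ultimately have "norm (a n) \<le> 1 / (1 + real m * l) * (1 + real m * (A - B) / 2)"
    by (simp add: field_simps)
  then show "norm (a n) \<le> 1 / (1 + (real n - 1) * l) * (1 + (real n - 1) * (A - B) / 2)"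
    using m by simp
qed

end
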